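(* Let $(X,d)$ be a compact metric space and let $\mu,\nu\in\mathcal{B}(X,d)$ be Borel probability measures on $X$. Then \[ \|M_\mu-M_\nu\|_\infty=\sup_{f\in O(X)}|M_\mu f-M_\nu f|\le w_1(\mu,\nu). \]
   Context: $\mathcal{B}(X,d)$ is the set of Borel probability measures on $(X,d)$. $O(X)$ is the set of all metric observables on $X$, i.e. 1-Lipschitz functions $f\colon X\to\mathbb{R}$ ($|f(x)-f(y)|\le d(x,y)$ for all $x,y\in X$). The observable mean $M_\mu\colon O(X)\to\mathbb{R}$ is $M_\mu f=M_\mu(f)=\int_X f\,d\mu$. The notation $\|M_\mu-M_\nu\|_\infty$ means the supremum over $f\in O(X)$ of $|M_\mu f-M_\nu f|$. Let $\Gamma(\mu,\nu)$ be the set of couplings, i.e. Borel probability measures $h$ on $X\times X$ whose first and second marginals are $\mu$ and $\nu$. The Wasserstein 1-distance is $w_1(\mu,\nu)=\inf_{h\in\Gamma(\mu,\nu)}\int_{X\times X}d(x,y)\,dh(x,y)$. *)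

theory Defs
  imports "HOL-Probability.Probability"
begin

text \<open>The space \<open>(X, d)\<close> is a type of class \<^class>\<open>metric_space\<close> with \<open>X = UNIV\<close> and
  \<open>d = dist\<close>. Suprema and infima are taken in \<^typ>\<open>ennreal\<close>, where they exist unconditionally.\<close>

definition borel_probs :: "'a::topological_space measure set" where
  "borel_probs = {\<mu>. prob_space \<mu> \<and> sets \<mu> = sets borel}"

definition metric_observables :: "('a::metric_space \<Rightarrow> real) set" where
  "metric_observables = {f. 1-lipschitz_on UNIV f}"

definition observable_mean :: "'a::metric_space measure \<Rightarrow> ('a \<Rightarrow> real) \<Rightarrow> real" where
  "observable_mean \<mu> f = (\<integral>x. f x \<partial>\<mu>)"

definition sup_norm_on :: "'b set \<Rightarrow> ('b \<Rightarrow> real) \<Rightarrow> ennreal" where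
  "sup_norm_on S \<phi> = (SUP s\<in>S. ennreal \<bar>\<phi> s\<bar>)"

text \<open>A coupling lives on the Borel sigma-algebra of the product topology on \<open>X \<times> X\<close>, i.e. on
  \<open>borel :: ('a \<times> 'a) measure\<close>; this makes \<open>dist\<close> measurable without any separability.\<close>

definition couplings ::
    "'a::metric_space measure \<Rightarrow> 'a measure \<Rightarrow> ('a \<times> 'a) measure set" where
  "couplings \<mu> \<nu> = {h \<in> borel_probs. distr h borel fst = \<mu> \<and> distr h borel snd = \<nu>}"

definition wasserstein1 :: "'a::metric_space measure \<Rightarrow> 'a measure \<Rightarrow> ennreal" where
  "wasserstein1 \<mu> \<nu> = (INF h\<in>couplings \<mu> \<nu>. \<integral>\<^sup>+ (x, y). ennreal (dist x y) \<partial>h)"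

end

theory Submission
  imports Defs
begin

text \<open>This is the easy half of Kantorovich--Rubinstein duality. A coupling \<open>h\<close> of \<open>\<mu>\<close> and \<open>\<nu>\<close>
  puts both means on one probability space: the difference of the means of \<open>f\<close> is the
  \<open>h\<close>-integral of \<open>f x - f y\<close>, and the Lipschitz condition bounds the integrand by \<open>dist x y\<close>
  (\<open>observable_mean_diff_le_transport_cost\<close>). Splitting the integral requires \<open>f\<close> to be integrable
  for both measures; on a compact space this holds because \<open>f\<close> is continuous, hence bounded
  (\<open>metric_observable_integrable\<close>).\<close>

lemma metric_observable_continuous:
  assumes "f \<in> metric_observables"
  shows "continuous_on UNIV f"
  using assms by (auto simp: metric_observables_def intro: lipschitz_on_continuous_on)

lemma metric_observable_integrable:
  fixes \<mu> :: "'a::metric_space measure"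
  assumes "compact (UNIV :: 'a set)" and \<mu>: "\<mu> \<in> borel_probs" and f: "f \<in> metric_observables"
  shows "integrable \<mu> f"
proof -
  interpret prob_space \<mu> using \<mu> by (simp add: borel_probs_def)
  have "bounded (range f)"
    using assms metric_observable_continuous by (blast intro: compact_imp_bounded compact_continuous_image)
  then obtain B where B: "\<And>x. norm (f x) \<le> B" by (auto simp: bounded_iff)
  have "f \<in> borel_measurable \<mu>"
    using \<mu> borel_measurable_continuous_onI[OF metric_observable_continuous[OF f]]
    by (simp add: borel_probs_def cong: measurable_cong_sets)
  then show ?thesis using B by (intro integrable_const_bound[of _ B]) auto
qed

text \<open>Change of variables along the two projections turns both means into integrals over the
  coupling, where they can be compared pointwise.\<close>

lemma observable_mean_diff_le_transport_cost:
  fixes \<mu> \<nu> :: "'a::metric_space measure"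
  assumes h: "h \<in> couplings \<mu> \<nu>" and f: "f \<in> metric_observables"
    and int: "integrable \<mu> f" "integrable \<nu> f"
  shows "ennreal \<bar>observable_mean \<mu> f - observable_mean \<nu> f\<bar>
           \<le> (\<integral>\<^sup>+ (x, y). ennreal (dist x y) \<partial>h)"
proof -
  have sets: "sets h = sets borel"
    and \<mu>: "\<mu> = distr h borel fst" and \<nu>: "\<nu> = distr h borel snd"
    using h by (auto simp: couplings_def borel_probs_def)
  have proj [measurable]: "fst \<in> h \<rightarrow>\<^sub>M borel" "snd \<in> h \<rightarrow>\<^sub>M borel"
    using sets by (auto intro!: borel_measurable_continuous_onI continuous_intros
        simp: measurable_cong_sets[OF sets refl])
  have f_meas [measurable]: "f \<in> borel_measurable borel"
    by (rule borel_measurable_continuous_onI[OF metric_observable_continuous[OF f]])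
  have int_h: "integrable h (\<lambda>z. f (fst z))" "integrable h (\<lambda>z. f (snd z))"
    using int unfolding \<mu> \<nu> by (simp_all add: integrable_distr_eq)
  have "observable_mean \<mu> f - observable_mean \<nu> f = (\<integral>z. f (fst z) - f (snd z) \<partial>h)"
    unfolding observable_mean_def \<mu> \<nu> using int_h by (simp add: integral_distr)
  also have "ennreal \<bar>\<dots>\<bar> \<le> (\<integral>\<^sup>+ z. ennreal \<bar>f (fst z) - f (snd z)\<bar> \<partial>h)"
    using integral_norm_bound_ennreal[of h "\<lambda>z. f (fst z) - f (snd z)"] int_h by simp
  also have "\<dots> \<le> (\<integral>\<^sup>+ (x, y). ennreal (dist x y) \<partial>h)"
    using f by (intro nn_integral_mono)
      (auto simp: metric_observables_def lipschitz_on_def dist_real_def intro!: ennreal_leI)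
  finally show ?thesis .
qed

theorem theorem5p1:
  fixes \<mu> \<nu> :: "'a::metric_space measure"
  assumes "compact (UNIV :: 'a set)"
    and "\<mu> \<in> borel_probs" and "\<nu> \<in> borel_probs"
  shows "sup_norm_on metric_observables (\<lambda>f. observable_mean \<mu> f - observable_mean \<nu> f)
           = (SUP f\<in>metric_observables. ennreal \<bar>observable_mean \<mu> f - observable_mean \<nu> f\<bar>)
       \<and> (SUP f\<in>metric_observables. ennreal \<bar>observable_mean \<mu> f - observable_mean \<nu> f\<bar>)
           \<le> wasserstein1 \<mu> \<nu>"
  unfolding sup_norm_on_def wasserstein1_def
  using assms
  by (auto intro!: SUP_least INF_greatest observable_mean_diff_le_transport_cost
      metric_observable_integrable)

end
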